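(* Let $a<b$ be real numbers and let $r,s$ be positive continuous functions on the interval $(a,b)$. Put $R(a,x)=\int_a^x r(t)\,dt$. Then for all measurable functions $f\ge 0$ on $(a,b)$ such that all integrals below exist and are finite, $$\left(\int_a^b r(x)\left(\int_x^b f(t)\,dt\right)dx\right)^2\le \left(\int_a^b \frac{R^2(a,x)}{s(x)}\,dx\right)\left(\int_a^b s(x)\,(f(x))^2\,dx\right).$$
   Context: Standing assumption: all functions are measurable and all the integrals appearing in the inequality (including the integrals defining $R(a,x)$ for $x\in(a,b)$ and $\int_x^b f$) exist and are finite. $R^2(a,x)$ means $(R(a,x))^2$. *)

theory Defs
  imports "HOL-Analysis.Analysis"
begin

definition R :: "(real \<Rightarrow> real) \<Rightarrow> real \<Rightarrow> real \<Rightarrow> real" where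
  "R r a x = (LINT t:{a<..<x}|lebesgue. r t)"

end

theory Submission
  imports Defs
begin

text \<open>
  By Tonelli on the triangle $a < x < t < b$, the left-hand integral equals
  $\int_a^b R(a,t)\,f(t)\,dt$; writing the integrand as
  $(R/\sqrt s)\cdot(\sqrt s\,f)$, the claim is the Cauchy--Schwarz inequality.
\<close>

text \<open>Completing keeps every measurable set together with its measure, so a countable cover by
  sets of finite measure survives. As \<open>lebesgue\<close> is the completion of
  \<open>lborel\<close>, this makes Tonelli available for it.\<close>

lemma sigma_finite_measure_completion:
  assumes "sigma_finite_measure M"
  shows "sigma_finite_measure (completion M)"
proof -
  interpret sigma_finite_measure M by fact
  from sigma_finite_countable obtain A where A: "countable A" "A \<subseteq> sets M" "\<Union>A = space M"
      "\<And>a. a \<in> A \<Longrightarrow> emeasure M a \<noteq> \<infinity>"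
    by blast
  show ?thesis
    by standard (use A in \<open>auto intro!: exI[of _ A] simp: subset_iff\<close>)
qed

text \<open>The bridge from the real integrals of the statement to \<open>ennreal\<close>, where
  Tonelli and Cauchy-Schwarz are applied. Integrability matters: the real integral of a
  non-integrable function is 0 by convention.\<close>

lemma ennreal_set_lebesgue_integral:
  fixes f :: "'a \<Rightarrow> real"
  assumes "set_integrable M A f" "\<And>x. x \<in> A \<Longrightarrow> 0 \<le> f x"
  shows "ennreal (LINT x:A|M. f x) = (\<integral>\<^sup>+x. ennreal (indicator A x * f x) \<partial>M)"
  using assms unfolding set_integrable_def set_lebesgue_integral_def
  by (subst nn_integral_eq_integral) (auto simp: indicator_def)

lemma sigma_finite_lebesgue: "sigma_finite_measure (lebesgue :: 'a::euclidean_space measure)"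
  by (intro sigma_finite_measure_completion lborel.sigma_finite_measure_axioms)

lemma borel_measurable_lebesgue_ident [measurable]:
  "(\<lambda>x. x) \<in> borel_measurable (lebesgue :: 'a::euclidean_space measure)"
  by (intro measurable_completion) simp

text \<open>The triangle is measurable in the product because both projections are Borel functions
  on it; this is what Tonelli asks of the cut-off.\<close>

lemma measurable_less_lebesgue_pair [measurable]:
  "Measurable.pred ((lebesgue :: real measure) \<Otimes>\<^sub>M (lebesgue :: real measure)) (\<lambda>z. fst z < snd z)"
proof -
  note id = borel_measurable_lebesgue_ident[where 'a = real]
  have [measurable]: "fst \<in> borel_measurable ((lebesgue :: real measure) \<Otimes>\<^sub>M (lebesgue :: real measure))"
    "snd \<in> borel_measurable ((lebesgue :: real measure) \<Otimes>\<^sub>M (lebesgue :: real measure))"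
    by (rule measurable_compose[OF measurable_fst id], rule measurable_compose[OF measurable_snd id])
  show "Measurable.pred ((lebesgue :: real measure) \<Otimes>\<^sub>M (lebesgue :: real measure)) (\<lambda>z. fst z < snd z)"
    by measurable
qed

text \<open>One condition \<open>x < t\<close>, read as a cut-off in \<open>t\<close> or in
  \<open>x\<close>. The \<open>if\<close> form exposes it as a predicate on pairs.\<close>

lemma indicator_greaterThan_if: "indicator {x<..} t = (if x < t then 1 else 0)"
  and indicator_lessThan_if: "indicator {..<t} x = (if x < t then 1 else 0)"
  by (auto simp: indicator_def)

lemma borel_measurable_nn_integral_lessThan:
  fixes f :: "real \<Rightarrow> ennreal"
  assumes [measurable]: "f \<in> borel_measurable lebesgue"
  shows "(\<lambda>t. \<integral>\<^sup>+x. f x * indicator {..<t} x \<partial>lebesgue) \<in> borel_measurable lebesgue"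
  unfolding indicator_lessThan_if
  by (rule sigma_finite_measure.borel_measurable_nn_integral[OF sigma_finite_lebesgue])
    (simp add: case_prod_unfold)

lemma nn_integral_swap_triangle:
  fixes f g :: "real \<Rightarrow> ennreal"
  assumes [measurable]: "f \<in> borel_measurable lebesgue" "g \<in> borel_measurable lebesgue"
  shows "(\<integral>\<^sup>+x. f x * (\<integral>\<^sup>+t. g t * indicator {x<..} t \<partial>lebesgue) \<partial>lebesgue)
       = (\<integral>\<^sup>+t. (\<integral>\<^sup>+x. f x * indicator {..<t} x \<partial>lebesgue) * g t \<partial>lebesgue)"
proof -
  interpret sigma_finite_measure "lebesgue :: real measure"
    by (rule sigma_finite_lebesgue)
  interpret pair_sigma_finite "lebesgue :: real measure" "lebesgue :: real measure" ..
  have "(\<integral>\<^sup>+x. f x * (\<integral>\<^sup>+t. g t * indicator {x<..} t \<partial>lebesgue) \<partial>lebesgue)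
      = (\<integral>\<^sup>+x. \<integral>\<^sup>+t. f x * (g t * indicator {x<..} t) \<partial>lebesgue \<partial>lebesgue)"
    by (intro nn_integral_cong nn_integral_cmult[symmetric]) measurable
  also have "\<dots> = (\<integral>\<^sup>+t. \<integral>\<^sup>+x. f x * (g t * indicator {x<..} t) \<partial>lebesgue \<partial>lebesgue)"
    unfolding indicator_greaterThan_if
    by (intro Fubini'[symmetric]) (simp add: case_prod_unfold)
  also have "\<dots> = (\<integral>\<^sup>+t. (\<integral>\<^sup>+x. f x * indicator {..<t} x \<partial>lebesgue) * g t \<partial>lebesgue)"
    \<comment> \<open>The cut-off is now read as one in \<open>x\<close>, so \<open>g t\<close> is
      constant for the inner integral and can be pulled out.\<close>
    unfolding indicator_greaterThan_if indicator_lessThan_if[symmetric]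
    by (subst nn_integral_multc[symmetric]) (simp_all add: mult_ac)
  finally show ?thesis .
qed

theorem theorem2p2:
  fixes a b :: real and r s f :: "real \<Rightarrow> real"
  assumes "a < b"
    and "continuous_on {a<..<b} r" and "\<And>x. x \<in> {a<..<b} \<Longrightarrow> r x > 0"
    and "continuous_on {a<..<b} s" and "\<And>x. x \<in> {a<..<b} \<Longrightarrow> s x > 0"
    and "set_borel_measurable lebesgue {a<..<b} f" and "\<And>x. x \<in> {a<..<b} \<Longrightarrow> f x \<ge> 0"
    and "\<And>x. x \<in> {a<..<b} \<Longrightarrow> set_integrable lebesgue {a<..<x} r"
    and "\<And>x. x \<in> {a<..<b} \<Longrightarrow> set_integrable lebesgue {x<..<b} f"
    and "set_integrable lebesgue {a<..<b} (\<lambda>x. r x * (LINT t:{x<..<b}|lebesgue. f t))"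
    and "set_integrable lebesgue {a<..<b} (\<lambda>x. (R r a x)\<^sup>2 / s x)"
    and "set_integrable lebesgue {a<..<b} (\<lambda>x. s x * (f x)\<^sup>2)"
  shows "(LINT x:{a<..<b}|lebesgue. r x * (LINT t:{x<..<b}|lebesgue. f t))\<^sup>2
      \<le> (LINT x:{a<..<b}|lebesgue. (R r a x)\<^sup>2 / s x)
        * (LINT x:{a<..<b}|lebesgue. s x * (f x)\<^sup>2)"
proof -
  let ?I = "{a<..<b}"
  let ?F = "\<lambda>x. LINT t:{x<..<b}|lebesgue. f t"
  note r_pos = assms(3) and s_pos = assms(5) and f_nonneg = assms(7)
  \<comment> \<open>Extension by zero: \<open>a\<close> and \<open>b\<close> disappear into the
    integrands, leaving the half-line cut-offs of the triangle swap.\<close>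
  define \<rho> \<phi> where "\<rho> x = ennreal (indicator ?I x * r x)" and "\<phi> x = ennreal (indicator ?I x * f x)" for x
  define G where "G t = (\<integral>\<^sup>+x. \<rho> x * indicator {..<t} x \<partial>lebesgue)" for t
  \<comment> \<open>Outside \<open>(a, b)\<close> both \<open>w\<close> and \<open>1 / w\<close> are 0, so \<open>w\<close> also does the cutting off.\<close>
  define w where "w x = sqrt (indicator ?I x * s x)" for x
  have cont: "(\<lambda>x. indicator ?I x * h x) \<in> borel_measurable lebesgue"
    if "continuous_on ?I h" for h :: "real \<Rightarrow> real"
    using borel_measurable_continuous_on_indicator[OF _ that]
    by (intro measurable_completion) simp
  have \<rho>_meas: "\<rho> \<in> borel_measurable lebesgue"
    unfolding \<rho>_def using cont[OF assms(2)] by simp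
  have \<phi>_meas [measurable]: "\<phi> \<in> borel_measurable lebesgue"
    using assms(6) unfolding \<phi>_def set_borel_measurable_def by simp
  have w_meas [measurable]: "w \<in> borel_measurable lebesgue"
    unfolding w_def using cont[OF assms(4)] by simp
  have G_meas [measurable]: "G \<in> borel_measurable lebesgue"
    unfolding G_def by (intro borel_measurable_nn_integral_lessThan \<rho>_meas)
  have F_nonneg: "?F x \<ge> 0" if "x \<in> ?I" for x
    using that f_nonneg by (auto simp: set_lebesgue_integral_def indicator_def intro!: integral_nonneg_AE)
  have R_nonneg: "R r a x \<ge> 0" if "x \<in> ?I" for x
    using that r_pos by (auto simp: R_def set_lebesgue_integral_def indicator_def less_imp_le intro!: integral_nonneg_AE)
  \<comment> \<open>Since \<open>a < x\<close>, the part of the interval beyond \<open>x\<close> is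
    exactly \<open>{x<..<b}\<close>. Symmetrically, \<open>t < b\<close> below identifies
    \<open>G t\<close> with the integral over \<open>{a<..<t}\<close>.\<close>
  have F_eq: "ennreal (?F x) = (\<integral>\<^sup>+t. \<phi> t * indicator {x<..} t \<partial>lebesgue)" if "x \<in> ?I" for x
    using that f_nonneg assms(9)[OF that]
    by (subst ennreal_set_lebesgue_integral)
      (auto simp: \<phi>_def indicator_def intro!: nn_integral_cong)
  have G_eq: "G t = ennreal (R r a t)" if "t \<in> ?I" for t
    unfolding R_def G_def using that r_pos assms(8)[OF that]
    by (subst ennreal_set_lebesgue_integral)
      (auto simp: \<rho>_def indicator_def less_imp_le intro!: nn_integral_cong)
  have "ennreal (LINT x:?I|lebesgue. r x * ?F x)
      = (\<integral>\<^sup>+x. \<rho> x * (\<integral>\<^sup>+t. \<phi> t * indicator {x<..} t \<partial>lebesgue) \<partial>lebesgue)"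
  proof (subst ennreal_set_lebesgue_integral[OF assms(10)])
    show "(\<integral>\<^sup>+x. ennreal (indicator ?I x * (r x * ?F x)) \<partial>lebesgue)
        = (\<integral>\<^sup>+x. \<rho> x * (\<integral>\<^sup>+t. \<phi> t * indicator {x<..} t \<partial>lebesgue) \<partial>lebesgue)"
    proof (intro nn_integral_cong)
      fix x
      show "ennreal (indicator ?I x * (r x * ?F x))
          = \<rho> x * (\<integral>\<^sup>+t. \<phi> t * indicator {x<..} t \<partial>lebesgue)"
      proof (cases "x \<in> ?I")
        case True
        then show ?thesis using r_pos[OF True] F_nonneg[OF True]
          by (simp add: \<rho>_def ennreal_mult flip: F_eq)
      \<comment> \<open>For \<open>x\<close> \<le> \<open>a\<close> the inner integral may be
        infinite, but \<open>\<rho> x\<close> is 0 and 0 times infinity is 0 in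
        \<open>ennreal\<close>.\<close>
      qed (simp add: \<rho>_def)
    qed
  qed (use r_pos F_nonneg in \<open>auto simp: less_imp_le\<close>)
  also have "\<dots> = (\<integral>\<^sup>+t. G t * \<phi> t \<partial>lebesgue)"
    unfolding G_def by (intro nn_integral_swap_triangle \<rho>_meas \<phi>_meas)
  also have "\<dots> = (\<integral>\<^sup>+t. (G t * ennreal (1 / w t)) * (\<phi> t * ennreal (w t)) \<partial>lebesgue)"
  proof (intro nn_integral_cong)
    fix t
    show "G t * \<phi> t = (G t * ennreal (1 / w t)) * (\<phi> t * ennreal (w t))"
    proof (cases "t \<in> ?I")
      case True
      then have "w t > 0" using s_pos[OF True] by (simp add: w_def)
      \<comment> \<open>The weights cancel as positive reals before passing to
        \<open>ennreal\<close>. Outside the interval both sides vanish with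
        \<open>\<phi>\<close>.\<close>
      then have "ennreal (1 / w t) * ennreal (w t) = 1"
        by (simp flip: ennreal_mult)
      then have "(G t * \<phi> t) * (ennreal (1 / w t) * ennreal (w t)) = G t * \<phi> t"
        by simp
      then show ?thesis by (simp add: mult_ac)
    qed (simp add: \<phi>_def)
  qed
  finally have lhs: "ennreal (LINT x:?I|lebesgue. r x * ?F x)
      = (\<integral>\<^sup>+t. (G t * ennreal (1 / w t)) * (\<phi> t * ennreal (w t)) \<partial>lebesgue)" .
  have rhs1: "(\<integral>\<^sup>+t. (G t * ennreal (1 / w t))\<^sup>2 \<partial>lebesgue) = ennreal (LINT x:?I|lebesgue. (R r a x)\<^sup>2 / s x)"
  proof (subst ennreal_set_lebesgue_integral[OF assms(11)])
    show "(\<integral>\<^sup>+t. (G t * ennreal (1 / w t))\<^sup>2 \<partial>lebesgue)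
        = (\<integral>\<^sup>+t. ennreal (indicator ?I t * ((R r a t)\<^sup>2 / s t)) \<partial>lebesgue)"
    proof (intro nn_integral_cong)
      fix t
      show "(G t * ennreal (1 / w t))\<^sup>2 = ennreal (indicator ?I t * ((R r a t)\<^sup>2 / s t))"
      proof (cases "t \<in> ?I")
        case True
        then show ?thesis using s_pos[OF True] R_nonneg[OF True]
          by (simp add: G_eq w_def ennreal_power power_divide flip: ennreal_mult)
      \<comment> \<open>For \<open>t\<close> \<ge> \<open>b\<close>, \<open>G t\<close> is the whole
        integral of \<open>r\<close>, positive and possibly infinite. It is killed by
        \<open>1 / w t\<close>, which is 0 because division by zero yields 0.\<close>
      qed (simp add: w_def)
    qed
  qed (use s_pos in \<open>auto simp: less_imp_le\<close>)
  have rhs2: "(\<integral>\<^sup>+t. (\<phi> t * ennreal (w t))\<^sup>2 \<partial>lebesgue) = ennreal (LINT x:?I|lebesgue. s x * (f x)\<^sup>2)"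
  proof (subst ennreal_set_lebesgue_integral[OF assms(12)])
    show "(\<integral>\<^sup>+t. (\<phi> t * ennreal (w t))\<^sup>2 \<partial>lebesgue)
        = (\<integral>\<^sup>+t. ennreal (indicator ?I t * (s t * (f t)\<^sup>2)) \<partial>lebesgue)"
    proof (intro nn_integral_cong)
      fix t
      show "(\<phi> t * ennreal (w t))\<^sup>2 = ennreal (indicator ?I t * (s t * (f t)\<^sup>2))"
      proof (cases "t \<in> ?I")
        case True
        \<comment> \<open>Positivity of \<open>s\<close> gives \<open>(w t)\<^sup>2 = s t\<close>,
          and \<open>f t\<close> \<ge> 0 lets \<open>ennreal\<close> commute with the
          products.\<close>
        then show ?thesis using s_pos[OF True] f_nonneg[OF True]
          by (simp add: \<phi>_def w_def ennreal_power power_mult_distrib mult.commute flip: ennreal_mult)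
      qed (simp add: w_def)
    qed
  qed (use s_pos in \<open>auto simp: less_imp_le\<close>)
  have nonneg: "(LINT x:?I|lebesgue. r x * ?F x) \<ge> 0" "(LINT x:?I|lebesgue. (R r a x)\<^sup>2 / s x) \<ge> 0"
    "(LINT x:?I|lebesgue. s x * (f x)\<^sup>2) \<ge> 0"
    using r_pos s_pos F_nonneg
    by (auto simp: set_lebesgue_integral_def indicator_def less_imp_le intro!: integral_nonneg_AE AE_I2)
  \<comment> \<open>Cauchy-Schwarz holds in \<open>ennreal\<close>. All three integrals being
    nonnegative reals, the square and the product move inside \<open>ennreal\<close>, which can then
    be dropped.\<close>
  have "ennreal ((LINT x:?I|lebesgue. r x * ?F x)\<^sup>2)
      \<le> ennreal ((LINT x:?I|lebesgue. (R r a x)\<^sup>2 / s x) * (LINT x:?I|lebesgue. s x * (f x)\<^sup>2))"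
    using Cauchy_Schwarz_nn_integral[of "\<lambda>t. G t * ennreal (1 / w t)" lebesgue "\<lambda>t. \<phi> t * ennreal (w t)"] nonneg
    by (simp add: lhs[symmetric] rhs1 rhs2 ennreal_power ennreal_mult)
  then show ?thesis
    using nonneg by (subst (asm) ennreal_le_iff) auto
qed

end
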